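(* Let $(w_k)_{k\ge0}$ be a weight sequence of nonnegative numbers such that $\sum_{k=0}^\infty w_kz^k=\infty$ for every $z>0$, let $\mathcal T_n$ be the simply generated random tree with $n$ vertices defined by $(w_k)$, and assume that its maximum outdegree satisfies $\Delta(\mathcal T_n)/n\to1$ in probability as $n\to\infty$. Then, as $n\to\infty$, $$\mathcal T_n\to\Upsilon_1\quad\text{in probability}.$$
   Context: Given a weight sequence $(w_k)_{k\ge0}$ with $w_k\ge0$, the weight of a finite rooted ordered tree $T$ is $w(T):=\prod_{v\in T}w_{\delta(v)}$, where $\delta(v)$ is the outdegree (number of children) of $v$. The simply generated tree $\mathcal T_n$ is the random rooted ordered tree with $n$ vertices with $\mathbb P(\mathcal T_n=T)$ proportional to $w(T)$; only $n$ for which some tree with $n$ vertices has positive weight are considered. $\Delta(T)$ is the maximum outdegree in $T$. $M_\infty$ is the Polish space of infinite real matrices $(a_{ij})_{i,j\ge1}$ with the product topology, and $\mathcal P(M_\infty)$ is the space of Borel probability measures on it with the weak topology. For a finite tree $T$, $\tau_\infty(T)\in\mathcal P(M_\infty)$ is the distribution of $(d_T(\xi_i,\xi_j)\mathbf 1\{i\ne j\})_{i,j\ge1}$, where $d_T$ is graph distance and $\xi_1,\xi_2,\dots$ are i.i.d. uniformly random vertices of $T$. $\Upsilon_a$ ($a\ge0$) is the long dendron whose base is a one-point real tree and whose measure on $\{\bullet\}\times[0,\infty)\cong[0,\infty)$ is $\delta_a$; its sampling measure $\tau_\infty(\Upsilon_a)$ is the point mass at the constant matrix $(2a\mathbf 1\{i\ne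 j\})_{i,j\ge1}$. For random trees, "$\mathcal T_n\to\Upsilon_1$ in probability" means that the random elements $\tau_\infty(\mathcal T_n)$ of $\mathcal P(M_\infty)$ converge in probability to $\tau_\infty(\Upsilon_1)$. *)

theory Defs
  imports "HOL-Probability.Probability"
begin

datatype tree = Node (children: "tree list")

text \<open>
  Vertices are addressed by their position (Ulam-Harris labels): the root is the empty list, and
  \<open>v @ [i]\<close> is the \<open>i\<close>-th child of \<open>v\<close>.
\<close>

lemma size_nth_less [termination_simp]: "i < length ts \<Longrightarrow> size (ts ! i) < Suc (size_list size ts)"
  using size_list_estimation'[of "ts ! i" ts "size (ts ! i)" size] by simp

fun vertices :: "tree \<Rightarrow> nat list set" where
  "vertices (Node ts) = insert [] (\<Union>i\<in>{..<length ts}. (#) i ` vertices (ts ! i))"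

definition tree_size :: "tree \<Rightarrow> nat" where
  "tree_size T = card (vertices T)"

definition outdegree :: "tree \<Rightarrow> nat list \<Rightarrow> nat" where
  "outdegree T v = card {i. v @ [i] \<in> vertices T}"

definition max_outdegree :: "tree \<Rightarrow> nat" where
  "max_outdegree T = Max (outdegree T ` vertices T)"

definition adjacent :: "tree \<Rightarrow> (nat list \<times> nat list) set" where
  "adjacent T = {(u, v). u \<in> vertices T \<and> v \<in> vertices T \<and> (\<exists>i. v = u @ [i] \<or> u = v @ [i])}"

definition graph_dist :: "tree \<Rightarrow> nat list \<Rightarrow> nat list \<Rightarrow> nat" where
  "graph_dist T u v = (LEAST k. (u, v) \<in> adjacent T ^^ k)"

lemma finite_vertices [simp]: "finite (vertices T)"
  by (induction T rule: vertices.induct) auto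

lemma Nil_in_vertices [simp]: "[] \<in> vertices T"
  by (cases T) auto

lemma vertices_nonempty [simp]: "vertices T \<noteq> {}"
  using Nil_in_vertices by blast

lemma tree_size_pos: "tree_size T > 0"
  by (simp add: tree_size_def card_gt_0_iff)

lemma tree_size_Node: "tree_size (Node ts) = Suc (\<Sum>t\<leftarrow>ts. tree_size t)"
proof -
  have "tree_size (Node ts) = Suc (card (\<Union>i\<in>{..<length ts}. (#) i ` vertices (ts ! i)))"
    unfolding tree_size_def vertices.simps by (subst card_insert_disjoint) auto
  also have "card (\<Union>i\<in>{..<length ts}. (#) i ` vertices (ts ! i))
      = (\<Sum>i<length ts. card ((#) i ` vertices (ts ! i)))"
    by (subst card_UN_disjoint) auto
  also have "\<dots> = (\<Sum>i<length ts. tree_size (ts ! i))"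
    by (simp add: card_image tree_size_def)
  also have "\<dots> = (\<Sum>t\<leftarrow>ts. tree_size t)"
    by (simp add: sum_list_sum_nth atLeast0LessThan)
  finally show ?thesis .
qed

lemma finite_trees_le: "finite {T. tree_size T \<le> n}"
proof (induction n)
  case 0
  then show ?case
    using tree_size_pos by (metis (no_types, lifting) Collect_empty_eq finite.emptyI le_zero_eq less_irrefl)
next
  case (Suc n)
  have "{T. tree_size T \<le> Suc n}
      \<subseteq> Node ` {ts. set ts \<subseteq> {T. tree_size T \<le> n} \<and> length ts \<le> n}"
  proof
    fix T assume "T \<in> {T. tree_size T \<le> Suc n}"
    moreover obtain ts where T: "T = Node ts" by (cases T)
    ultimately have le: "(\<Sum>t\<leftarrow>ts. tree_size t) \<le> n" by (simp add: tree_size_Node)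
    have "tree_size t \<le> n" if "t \<in> set ts" for t
      using le member_le_sum_list[of "tree_size t" "map tree_size ts"] that by force
    moreover have "length ts \<le> (\<Sum>t\<leftarrow>ts. tree_size t)"
    proof (induction ts)
      case (Cons t ts)
      then show ?case using tree_size_pos[of t] by simp
    qed simp
    ultimately show "T \<in> Node ` {ts. set ts \<subseteq> {T. tree_size T \<le> n} \<and> length ts \<le> n}"
      using le T by auto
  qed
  then show ?case
    by (rule finite_subset) (intro finite_imageI finite_lists_length_le Suc.IH)
qed

lemma finite_trees_of_size: "finite {T. tree_size T = n}"
  by (rule finite_subset[OF _ finite_trees_le[of n]]) auto

definition weight :: "(nat \<Rightarrow> real) \<Rightarrow> tree \<Rightarrow> real" where
  "weight w T = (\<Prod>v\<in>vertices T. w (outdegree T v))"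

definition partition_function :: "(nat \<Rightarrow> real) \<Rightarrow> nat \<Rightarrow> real" where
  "partition_function w n = (\<Sum>T | tree_size T = n. weight w T)"

definition admissible :: "(nat \<Rightarrow> real) \<Rightarrow> nat \<Rightarrow> bool" where
  "admissible w n \<longleftrightarrow> (\<exists>T. tree_size T = n \<and> weight w T > 0)"

text \<open>
  The limit \<open>n \<rightarrow> \<infinity>\<close> runs through the admissible \<open>n\<close> only.
\<close>

definition admissible_at_top :: "(nat \<Rightarrow> real) \<Rightarrow> nat filter" where
  "admissible_at_top w = inf at_top (principal {n. admissible w n})"

text \<open>
  The law of the simply generated tree with \<open>n\<close> vertices; meaningful for admissible \<open>n\<close>
  (see \<open>pmf_simply_generated_tree\<close> below).
\<close>

definition simply_generated_tree :: "(nat \<Rightarrow> real) \<Rightarrow> nat \<Rightarrow> tree pmf" where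
  "simply_generated_tree w n =
     embed_pmf (\<lambda>T. if tree_size T = n then weight w T / partition_function w n else 0)"

lemma weight_nonneg: "(\<And>k. 0 \<le> w k) \<Longrightarrow> 0 \<le> weight w T"
  unfolding weight_def by (intro prod_nonneg) auto

lemma partition_function_pos:
  assumes "\<And>k. 0 \<le> w k" and "admissible w n"
  shows "partition_function w n > 0"
proof -
  obtain T where T: "tree_size T = n" "weight w T > 0"
    using assms(2) by (auto simp: admissible_def)
  show ?thesis
    unfolding partition_function_def
    by (rule sum_pos2[of _ T]) (use T assms(1) weight_nonneg finite_trees_of_size in auto)
qed

lemma pmf_simply_generated_tree:
  assumes "\<And>k. 0 \<le> w k" and "admissible w n"
  shows "pmf (simply_generated_tree w n) T =
    (if tree_size T = n then weight w T / partition_function w n else 0)"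
proof -
  let ?Z = "partition_function w n"
  let ?f = "\<lambda>T. if tree_size T = n then weight w T / ?Z else 0"
  have Z: "?Z > 0" using assms by (rule partition_function_pos)
  have nonneg: "0 \<le> ?f T" for T using Z weight_nonneg[OF assms(1)] by auto
  have "(\<integral>\<^sup>+T. ennreal (?f T) \<partial>count_space UNIV)
      = (\<Sum>T | tree_size T = n. ennreal (?f T))"
    by (intro nn_integral_count_space'[OF finite_trees_of_size]) auto
  also have "\<dots> = ennreal (\<Sum>T | tree_size T = n. weight w T / ?Z)"
    using Z weight_nonneg[OF assms(1)] by (subst sum_ennreal[symmetric]) (auto intro!: sum.cong)
  also have "(\<Sum>T | tree_size T = n. weight w T / ?Z) = 1"
    using Z by (simp add: sum_divide_distrib[symmetric] partition_function_def)
  finally have "(\<integral>\<^sup>+T. ennreal (?f T) \<partial>count_space UNIV) = 1" by simp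
  then show ?thesis
    unfolding simply_generated_tree_def using nonneg by (subst pmf_embed_pmf) auto
qed

definition borel_prob_measures :: "'a::topological_space measure set" where
  "borel_prob_measures = {\<mu>. prob_space \<mu> \<and> sets \<mu> = sets borel}"

text \<open>
  The coarsest topology for which \<open>\<mu> \<mapsto> \<integral>f d\<mu>\<close> is continuous for every bounded continuous \<open>f\<close>.
\<close>

definition weak_topology :: "'a::topological_space measure topology" where
  "weak_topology = topology_generated_by
     {{\<mu> \<in> borel_prob_measures. (\<integral>x. f x \<partial>\<mu>) \<in> V} | (f :: 'a \<Rightarrow> real) V.
        continuous_on UNIV f \<and> bounded (range f) \<and> open V}"

lemma topspace_weak_topology: "topspace weak_topology = borel_prob_measures"
proof -
  have "borel_prob_measures = {\<mu> \<in> borel_prob_measures. (\<integral>x. 0 \<partial>\<mu>) \<in> (UNIV :: real set)}"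
    by simp
  moreover have "continuous_on UNIV (\<lambda>_::'a. 0::real)" "bounded (range (\<lambda>_::'a. 0::real))"
    by auto
  ultimately show ?thesis
    unfolding weak_topology_def topology_generated_by_topspace by blast
qed

text \<open>
  Convergence in probability of the random elements \<open>f i\<close>, defined on the discrete probability
  spaces \<open>p i\<close>, to the constant \<open>c\<close> along the filter \<open>F\<close>. For a metrizable topology this is the usual
  notion, for every compatible metric (\<open>tendsto_in_prob_metric\<close>).
\<close>

definition tendsto_in_prob ::
    "'b topology \<Rightarrow> ('i \<Rightarrow> 'a pmf) \<Rightarrow> ('i \<Rightarrow> 'a \<Rightarrow> 'b) \<Rightarrow> 'b \<Rightarrow> 'i filter \<Rightarrow> bool" where
  "tendsto_in_prob X p f c F \<longleftrightarrow>
     (\<forall>U. openin X U \<and> c \<in> U \<longrightarrow>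
        ((\<lambda>i. measure_pmf.prob (p i) {\<omega>. f i \<omega> \<in> U}) \<longlongrightarrow> 1) F)"

lemma (in Metric_space) tendsto_in_prob_metric:
  assumes "c \<in> M" and f: "\<And>i \<omega>. f i \<omega> \<in> M"
  shows "tendsto_in_prob mtopology p f c F \<longleftrightarrow>
    (\<forall>\<epsilon>>0. ((\<lambda>i. measure_pmf.prob (p i) {\<omega>. d (f i \<omega>) c > \<epsilon>}) \<longlongrightarrow> 0) F)"
proof (intro iffI allI impI)
  fix \<epsilon> :: real
  assume *: "tendsto_in_prob mtopology p f c F" and "\<epsilon> > 0"
  then have "((\<lambda>i. measure_pmf.prob (p i) {\<omega>. f i \<omega> \<in> mball c \<epsilon>}) \<longlongrightarrow> 1) F"
    using \<open>c \<in> M\<close> unfolding tendsto_in_prob_def by (auto simp: openin_mball)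
  then have lim: "((\<lambda>i. 1 - measure_pmf.prob (p i) {\<omega>. f i \<omega> \<in> mball c \<epsilon>}) \<longlongrightarrow> 0) F"
    using tendsto_diff[OF tendsto_const, of _ 1 F 1] by simp
  have "measure_pmf.prob (p i) {\<omega>. d (f i \<omega>) c > \<epsilon>}
      \<le> 1 - measure_pmf.prob (p i) {\<omega>. f i \<omega> \<in> mball c \<epsilon>}" for i
  proof -
    have "1 - measure_pmf.prob (p i) {\<omega>. f i \<omega> \<in> mball c \<epsilon>}
        = measure_pmf.prob (p i) (UNIV - {\<omega>. f i \<omega> \<in> mball c \<epsilon>})"
      by (subst measure_pmf.prob_compl[symmetric]) auto
    moreover have "{\<omega>. d (f i \<omega>) c > \<epsilon>} \<subseteq> UNIV - {\<omega>. f i \<omega> \<in> mball c \<epsilon>}"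
      using commute by (auto simp: in_mball)
    ultimately show ?thesis
      by (simp add: measure_pmf.finite_measure_mono)
  qed
  then show "((\<lambda>i. measure_pmf.prob (p i) {\<omega>. d (f i \<omega>) c > \<epsilon>}) \<longlongrightarrow> 0) F"
    by (intro tendsto_sandwich[OF _ _ tendsto_const lim]) auto
next
  assume *: "\<forall>\<epsilon>>0. ((\<lambda>i. measure_pmf.prob (p i) {\<omega>. d (f i \<omega>) c > \<epsilon>}) \<longlongrightarrow> 0) F"
  show "tendsto_in_prob mtopology p f c F"
    unfolding tendsto_in_prob_def
  proof (intro allI impI)
    fix U assume U: "openin mtopology U \<and> c \<in> U"
    then obtain r where r: "r > 0" "mball c r \<subseteq> U" by (auto simp: openin_mtopology)
    have "((\<lambda>i. measure_pmf.prob (p i) {\<omega>. d (f i \<omega>) c > r / 2}) \<longlongrightarrow> 0) F"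
      using * half_gt_zero[OF r(1)] by blast
    then have lim: "((\<lambda>i. 1 - measure_pmf.prob (p i) {\<omega>. d (f i \<omega>) c > r / 2}) \<longlongrightarrow> 1) F"
      using tendsto_diff[OF tendsto_const, of _ 0 F 1] by simp
    have "1 - measure_pmf.prob (p i) {\<omega>. d (f i \<omega>) c > r / 2}
        \<le> measure_pmf.prob (p i) {\<omega>. f i \<omega> \<in> U}" for i
    proof -
      have "1 - measure_pmf.prob (p i) {\<omega>. d (f i \<omega>) c > r / 2}
          = measure_pmf.prob (p i) (UNIV - {\<omega>. d (f i \<omega>) c > r / 2})"
        by (subst measure_pmf.prob_compl[symmetric]) auto
      moreover have "UNIV - {\<omega>. d (f i \<omega>) c > r / 2} \<subseteq> {\<omega>. f i \<omega> \<in> U}"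
      proof
        fix \<omega> assume "\<omega> \<in> UNIV - {\<omega>. d (f i \<omega>) c > r / 2}"
        then have "d c (f i \<omega>) < r" using commute[of c "f i \<omega>"] r(1) by simp
        then show "\<omega> \<in> {\<omega>. f i \<omega> \<in> U}" using r(2) f \<open>c \<in> M\<close> by (auto simp: in_mball)
      qed
      ultimately show ?thesis
        by (simp add: measure_pmf.finite_measure_mono)
    qed
    then show "((\<lambda>i. measure_pmf.prob (p i) {\<omega>. f i \<omega> \<in> U}) \<longlongrightarrow> 1) F"
      by (intro tendsto_sandwich[OF _ _ lim tendsto_const]) auto
  qed
qed

text \<open>
  The space \<open>M\<^sub>\<infinity>\<close> of infinite real matrices is the type \<open>nat \<Rightarrow> nat \<Rightarrow> real\<close>, whose library topology is
  the product topology; indices start at 0 instead of 1. The law of the matrix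
  \<open>(d(\<xi>\<^sub>i, \<xi>\<^sub>j) 1{i \<noteq> j})\<close> for i.i.d. \<open>\<xi>\<^sub>0, \<xi>\<^sub>1, \<dots>\<close> with law \<open>\<nu>\<close>:
\<close>

definition sampling_measure ::
    "('v \<Rightarrow> 'v \<Rightarrow> real) \<Rightarrow> 'v measure \<Rightarrow> (nat \<Rightarrow> nat \<Rightarrow> real) measure" where
  "sampling_measure d \<nu> =
     distr (\<Pi>\<^sub>M i\<in>UNIV. \<nu>) borel (\<lambda>\<xi> i j. if i = j then 0 else d (\<xi> i) (\<xi> j))"

definition tree_sampling :: "tree \<Rightarrow> (nat \<Rightarrow> nat \<Rightarrow> real) measure" where
  "tree_sampling T =
     sampling_measure (\<lambda>u v. real (graph_dist T u v)) (measure_pmf (pmf_of_set (vertices T)))"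

text \<open>
  A long dendron consists of a base (a real tree with metric \<open>\<rho>\<close>) and a probability measure \<open>\<nu>\<close> on
  base \<open>\<times> [0, \<infinity>)\<close>; the second coordinate is the length of a leg attached at the first, and two
  distinct samples are joined through the base.
\<close>

definition dendron_sampling ::
    "('p \<Rightarrow> 'p \<Rightarrow> real) \<Rightarrow> ('p \<times> real) measure \<Rightarrow> (nat \<Rightarrow> nat \<Rightarrow> real) measure" where
  "dendron_sampling \<rho> \<nu> = sampling_measure (\<lambda>(x, s) (y, t). \<rho> x y + s + t) \<nu>"

definition Upsilon_sampling :: "real \<Rightarrow> (nat \<Rightarrow> nat \<Rightarrow> real) measure" where
  "Upsilon_sampling a =
     dendron_sampling (\<lambda>_ _. 0) (return (count_space {()} \<Otimes>\<^sub>M borel) ((), a))"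

lemma measurable_sampling:
  fixes d :: "'v \<Rightarrow> 'v \<Rightarrow> real"
  assumes [measurable]: "(\<lambda>(x, y). d x y) \<in> borel_measurable (\<nu> \<Otimes>\<^sub>M \<nu>)"
  shows "(\<lambda>\<xi> (i::nat) (j::nat). if i = j then 0 else d (\<xi> i) (\<xi> j))
    \<in> borel_measurable (\<Pi>\<^sub>M i\<in>UNIV. \<nu>)"
proof (rule measurable_coordinatewise_then_product, rule measurable_coordinatewise_then_product)
  fix i j :: nat
  show "(\<lambda>\<xi>. if i = j then 0 else d (\<xi> i) (\<xi> j)) \<in> borel_measurable (\<Pi>\<^sub>M i\<in>UNIV. \<nu>)"
    by measurable
qed

lemma sampling_measure_in_borel_prob_measures:
  assumes "prob_space \<nu>" and "(\<lambda>(x, y). d x y) \<in> borel_measurable (\<nu> \<Otimes>\<^sub>M \<nu>)"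
  shows "sampling_measure d \<nu> \<in> borel_prob_measures"
proof -
  interpret product_prob_space "\<lambda>_::nat. \<nu>" UNIV
    using assms(1) by (simp add: product_prob_space_def product_prob_space_axioms_def
        product_sigma_finite_def prob_space_imp_sigma_finite)
  show ?thesis
    unfolding borel_prob_measures_def sampling_measure_def
    using prob_space_distr[OF measurable_sampling[OF assms(2)]] by simp
qed

lemma tree_sampling_in_borel_prob_measures: "tree_sampling T \<in> borel_prob_measures"
  unfolding tree_sampling_def
proof (rule sampling_measure_in_borel_prob_measures)
  show "(\<lambda>(x, y). real (graph_dist T x y)) \<in> borel_measurable
      (measure_pmf (pmf_of_set (vertices T)) \<Otimes>\<^sub>M measure_pmf (pmf_of_set (vertices T)))"
    by (subst measurable_cong_sets[OF sets_pair_measure_cong[OF sets_measure_pmf_count_space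
          sets_measure_pmf_count_space] refl])
      (simp add: pair_measure_countable)
qed (rule prob_space_measure_pmf)

lemma Upsilon_sampling_eq:
  "Upsilon_sampling a = return borel (\<lambda>i j. if i = j then 0 else 2 * a)"
proof -
  let ?S = "count_space {()} \<Otimes>\<^sub>M (borel :: real measure)"
  let ?R = "return ?S ((), a)"
  let ?P = "\<Pi>\<^sub>M i\<in>(UNIV :: nat set). ?R"
  let ?h = "\<lambda>(\<xi> :: nat \<Rightarrow> unit \<times> real) (i::nat) (j::nat).
      if i = j then 0 else snd (\<xi> i) + snd (\<xi> j)"
  have R: "prob_space ?R" by (intro prob_space_return) (simp add: space_pair_measure)
  interpret product_prob_space "\<lambda>_::nat. ?R" UNIV
    using R by (simp add: product_prob_space_def product_prob_space_axioms_def
        product_sigma_finite_def prob_space_imp_sigma_finite)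
  have sets_R: "sets (?R \<Otimes>\<^sub>M ?R) = sets (?S \<Otimes>\<^sub>M ?S)"
    by (intro sets_pair_measure_cong sets_return)
  have meas: "?h \<in> borel_measurable ?P"
    by (rule measurable_sampling[of "\<lambda>x y. snd x + snd y"])
      (subst measurable_cong_sets[OF sets_R refl], measurable)
  have *: "Upsilon_sampling a = distr ?P borel ?h"
    by (simp add: Upsilon_sampling_def dendron_sampling_def sampling_measure_def
        split_beta' case_prod_unfold)
  have "AE \<xi> in ?P. \<forall>i::nat. snd (\<xi> i) = a"
    unfolding AE_all_countable
  proof
    fix i :: nat
    have "AE x in ?R. snd x = a"
      by (subst AE_return) (auto simp: space_pair_measure)
    then show "AE \<xi> in ?P. snd (\<xi> i) = a"
      by (intro AE_component) auto
  qed
  then have "AE \<xi> in ?P. ?h \<xi> = (\<lambda>(i::nat) (j::nat). if i = j then 0 else 2 * a)"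
    by (rule eventually_mono) (auto simp: fun_eq_iff)
  then have "distr ?P borel ?h
      = distr ?P borel (\<lambda>_ i j. if i = j then 0 else 2 * a)"
    by (rule distr_cong_AE[OF refl refl _ meas measurable_const]) simp
  also have "\<dots> = return borel (\<lambda>i j. if i = j then 0 else 2 * a)"
    by (rule distr_const) simp
  finally show ?thesis unfolding * .
qed

end

theory Submission
  imports Defs
begin

text \<open>
  Let \<open>v\<close> be a vertex of maximum outdegree \<open>D\<close> in a tree with \<open>n\<close> vertices. Two distinct children of
  \<open>v\<close> are at distance 2, so a given off-diagonal entry of the sampled matrix equals 2 with probability at
  least \<open>D (D - 1) / n\<^sup>2\<close>. A continuous function of the matrix depends, up to \<open>\<epsilon>\<close> and near
  the constant matrix, on finitely many entries only, so its integral against the sampling measure is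
  close to its value at the limit as soon as \<open>D / n\<close> is close to 1 and \<open>n\<close> is large.
\<close>

section \<open>Convergence in probability\<close>

text \<open>Since the limit is a constant, the sets that either miss \<open>c\<close> or are hit
  with probability tending to 1 are closed under finite intersections and arbitrary unions. Testing
  a subbase therefore suffices, and \<open>weak_topology\<close> is given by one, so no metric on
  the space of measures has to be chosen.\<close>

lemma tendsto_in_prob_topology_generated_by:
  assumes "\<And>S. S \<in> \<S> \<Longrightarrow> c \<in> S \<Longrightarrow>
    ((\<lambda>i. measure_pmf.prob (p i) {\<omega>. f i \<omega> \<in> S}) \<longlongrightarrow> 1) F"
  shows "tendsto_in_prob (topology_generated_by \<S>) p f c F"
proof -
  let ?P = "\<lambda>U. c \<in> U \<longrightarrow> ((\<lambda>i. measure_pmf.prob (p i) {\<omega>. f i \<omega> \<in> U}) \<longlongrightarrow> 1) F"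
  have "?P U" if "generate_topology_on \<S> U" for U
    using that
  proof (induction rule: generate_topology_on.induct)
    case Empty
    then show ?case by simp
  next
    case (Int a b)
    show ?case
    proof
      assume "c \<in> a \<inter> b"
      then have lim: "((\<lambda>i. measure_pmf.prob (p i) {\<omega>. f i \<omega> \<in> a}
          + measure_pmf.prob (p i) {\<omega>. f i \<omega> \<in> b} - 1) \<longlongrightarrow> 1 + 1 - 1) F"
        using Int.IH by (intro tendsto_intros) auto
      \<comment> \<open>Inclusion-exclusion, with the probability of the union bounded by 1.\<close>
      have "measure_pmf.prob (p i) {\<omega>. f i \<omega> \<in> a} + measure_pmf.prob (p i) {\<omega>. f i \<omega> \<in> b} - 1
          \<le> measure_pmf.prob (p i) {\<omega>. f i \<omega> \<in> a \<inter> b}" for i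
      proof -
        let ?A = "{\<omega>. f i \<omega> \<in> a}" and ?B = "{\<omega>. f i \<omega> \<in> b}"
        have "measure_pmf.prob (p i) (?A \<union> ?B) = measure_pmf.prob (p i) ?A
            + measure_pmf.prob (p i) ?B - measure_pmf.prob (p i) (?A \<inter> ?B)"
          by (rule measure_Un3) (auto simp: fmeasurable_def measure_pmf.emeasure_eq_measure)
        moreover have "?A \<inter> ?B = {\<omega>. f i \<omega> \<in> a \<inter> b}" by auto
        ultimately show ?thesis
          using measure_pmf.prob_le_1[of "p i" "?A \<union> ?B"] by simp
      qed
      then show "((\<lambda>i. measure_pmf.prob (p i) {\<omega>. f i \<omega> \<in> a \<inter> b}) \<longlongrightarrow> 1) F"
        by (intro tendsto_sandwich[OF _ _ lim[simplified] tendsto_const]) auto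
    qed
  next
    case (UN K)
    show ?case
    proof
      assume "c \<in> \<Union>K"
      then obtain k where k: "k \<in> K" "c \<in> k" by blast
      have "measure_pmf.prob (p i) {\<omega>. f i \<omega> \<in> k} \<le> measure_pmf.prob (p i) {\<omega>. f i \<omega> \<in> \<Union>K}" for i
        using k by (intro measure_pmf.finite_measure_mono) auto
      then show "((\<lambda>i. measure_pmf.prob (p i) {\<omega>. f i \<omega> \<in> \<Union>K}) \<longlongrightarrow> 1) F"
        by (intro tendsto_sandwich[OF _ _ UN.IH[OF k(1), rule_format, OF k(2)]
            tendsto_const]) auto
    qed
  next
    case (Basis s)
    then show ?case using assms by blast
  qed
  then show ?thesis
    by (simp add: tendsto_in_prob_def openin_topology_generated_by_iff)
qed

section \<open>Sampled matrices close to a fixed matrix\<close>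

lemma tendsto_infinite_matrix:
  fixes a :: "nat \<Rightarrow> nat \<Rightarrow> nat \<Rightarrow> real"
  assumes "\<And>i j. ((\<lambda>k. a k i j) \<longlongrightarrow> c i j) F"
  shows "(a \<longlongrightarrow> c) F"
  using assms
  unfolding limitin_canonical_iff[symmetric] euclidean_product_topology[symmetric] limitin_componentwise
  by (auto simp: extensional_def)

text \<open>If no block size worked, there would be for each \<open>N\<close> a matrix agreeing with
  \<open>c\<close> on the \<open>N\<close> by \<open>N\<close> block and violating the bound. These
  matrices converge entrywise, hence in the product topology, to \<open>c\<close>, against
  continuity of \<open>f\<close> at \<open>c\<close>.\<close>

lemma continuous_infinite_matrix_finite_dependence:
  fixes f :: "(nat \<Rightarrow> nat \<Rightarrow> real) \<Rightarrow> real"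
  assumes "continuous_on UNIV f" and "e > 0"
  obtains N where "\<And>a. (\<And>i j. i < N \<Longrightarrow> j < N \<Longrightarrow> a i j = c i j) \<Longrightarrow> \<bar>f a - f c\<bar> < e"
proof (rule ccontr)
  assume "\<not> thesis"
  then have "\<forall>N. \<exists>a. (\<forall>i<N. \<forall>j<N. a i j = c i j) \<and> \<bar>f a - f c\<bar> \<ge> e"
    using that by (metis not_less)
  then obtain a where a: "\<And>N i j. i < N \<Longrightarrow> j < N \<Longrightarrow> a N i j = c i j"
      "\<And>N. \<bar>f (a N) - f c\<bar> \<ge> e"
    by metis
  have "a \<longlonglongrightarrow> c"
  proof (rule tendsto_infinite_matrix)
    fix i j
    have "eventually (\<lambda>N. a N i j = c i j) sequentially"
      using eventually_gt_at_top[of "max i j"] by eventually_elim (simp add: a)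
    then show "(\<lambda>N. a N i j) \<longlonglongrightarrow> c i j" by (rule tendsto_eventually)
  qed
  then have "(\<lambda>N. f (a N)) \<longlonglongrightarrow> f c"
    using assms(1) continuous_on_tendsto_compose[of UNIV f a c] by simp
  then have "eventually (\<lambda>N. \<bar>f (a N) - f c\<bar> < e) sequentially"
    using assms(2) by (auto simp: tendsto_iff dist_real_def)
  then show False
    using a(2) by (auto simp: eventually_sequentially not_less[symmetric])
qed

text \<open>Integrate the pointwise bound by \<open>e + K * indicator B\<close>: \<open>e\<close>
  controls the good event, the crude bound \<open>K\<close> the bad event \<open>B\<close>.\<close>

lemma (in prob_space) abs_expectation_diff_le:
  fixes g :: "'a \<Rightarrow> real"
  assumes [measurable]: "g \<in> borel_measurable M" "B \<in> events"
    and K: "\<And>x. x \<in> space M \<Longrightarrow> \<bar>g x - a\<bar> \<le> K"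
    and e: "e \<ge> 0" "\<And>x. x \<in> space M - B \<Longrightarrow> \<bar>g x - a\<bar> \<le> e"
  shows "\<bar>expectation g - a\<bar> \<le> e + K * prob B"
proof -
  have int: "integrable M (\<lambda>x. g x - a)"
    by (rule integrable_const_bound[where B = K]) (auto simp: K)
  have ind: "integrable M (\<lambda>x. K * indicator B x)"
    by (intro integrable_mult_right integrable_real_indicator) (auto simp: emeasure_eq_measure)
  \<comment> \<open>Only \<open>g - a\<close> is bounded by assumption; integrability of
    \<open>g\<close> itself is needed to split the integral below.\<close>
  from int have "integrable M (\<lambda>x. (g x - a) + a)" by (intro Bochner_Integration.integrable_add) auto
  then have "integrable M g" by simp
  then have "expectation g - a = (\<integral>x. g x - a \<partial>M)"
    by (subst Bochner_Integration.integral_diff) (auto simp: prob_space)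
  also have "\<bar>\<dots>\<bar> \<le> (\<integral>x. \<bar>g x - a\<bar> \<partial>M)" by (rule integral_abs_bound)
  also have "\<dots> \<le> (\<integral>x. e + K * indicator B x \<partial>M)"
  proof (rule integral_mono)
    show "integrable M (\<lambda>x. \<bar>g x - a\<bar>)" using int by (rule integrable_abs)
    show "integrable M (\<lambda>x. e + K * indicator B x)"
      using ind by (intro Bochner_Integration.integrable_add) auto
    show "\<bar>g x - a\<bar> \<le> e + K * indicator B x" if "x \<in> space M" for x
      using K[OF that] e that by (cases "x \<in> B") auto
  qed
  also have "\<dots> = e + K * prob B"
    using ind by (subst Bochner_Integration.integral_add) (auto simp: prob_space)
  finally show ?thesis .
qed

lemma product_prob_space_pmf: "product_prob_space (\<lambda>_::'i. measure_pmf p)"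
  by (simp add: product_prob_space_def product_prob_space_axioms_def
      product_sigma_finite_def prob_space_imp_sigma_finite prob_space_measure_pmf)

text \<open>The event is a cylinder over the two coordinates \<open>i\<close> and \<open>j\<close>,
  so independence gives the product. Distinctness of \<open>i\<close> and \<open>j\<close> makes
  \<open>?X\<close> take the value \<open>{v}\<close> at \<open>j\<close> and gives the product over
  \<open>{i, j}\<close> two factors.\<close>

lemma PiM_pmf_pair:
  fixes p :: "'v pmf" and i j :: nat
  assumes "i \<noteq> j"
  shows "{\<xi>. \<xi> i = u \<and> \<xi> j = v} \<in> sets (\<Pi>\<^sub>M _\<in>UNIV. measure_pmf p)" (is ?sets)
    and "measure (\<Pi>\<^sub>M _\<in>UNIV. measure_pmf p) {\<xi>. \<xi> i = u \<and> \<xi> j = v} = pmf p u * pmf p v" (is ?prob)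
proof -
  let ?P = "\<Pi>\<^sub>M _\<in>(UNIV::nat set). measure_pmf p"
  let ?X = "\<lambda>k. if k = i then {u} else {v}"
  interpret product_prob_space "\<lambda>_::nat. measure_pmf p" UNIV by (rule product_prob_space_pmf)
  have eq: "{\<xi>. \<xi> i = u \<and> \<xi> j = v} = prod_emb UNIV (\<lambda>_. measure_pmf p) {i, j} (Pi\<^sub>E {i, j} ?X)"
    using assms by (auto simp: prod_emb_def space_PiM PiE_iff)
  show ?sets unfolding eq by (rule sets_PiM_I) auto
  have "measure ?P {\<xi>. \<xi> i = u \<and> \<xi> j = v} = (\<Prod>k\<in>{i, j}. measure (measure_pmf p) (?X k))"
    unfolding eq by (rule measure_PiM_emb) auto
  then show ?prob using assms by (simp add: measure_pmf_single)
qed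

lemma PiM_pmf_pair_in:
  fixes p :: "'v pmf" and i j :: nat
  assumes "i \<noteq> j" and "finite A"
  shows "{\<xi>. (\<xi> i, \<xi> j) \<in> A} \<in> sets (\<Pi>\<^sub>M _\<in>UNIV. measure_pmf p)" (is ?sets)
    and "measure (\<Pi>\<^sub>M _\<in>UNIV. measure_pmf p) {\<xi>. (\<xi> i, \<xi> j) \<in> A}
      = (\<Sum>(u, v)\<in>A. pmf p u * pmf p v)" (is ?prob)
proof -
  let ?P = "\<Pi>\<^sub>M _\<in>(UNIV::nat set). measure_pmf p"
  let ?E = "\<lambda>x. {\<xi> :: nat \<Rightarrow> 'v. \<xi> i = fst x \<and> \<xi> j = snd x}"
  interpret product_prob_space "\<lambda>_::nat. measure_pmf p" UNIV by (rule product_prob_space_pmf)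
  have eq: "{\<xi>. (\<xi> i, \<xi> j) \<in> A} = (\<Union>x\<in>A. ?E x)" by force
  show ?sets
    unfolding eq using assms by (intro sets.finite_UN PiM_pmf_pair) auto
  have "measure ?P (\<Union>x\<in>A. ?E x) = (\<Sum>x\<in>A. measure ?P (?E x))"
    by (rule P.finite_measure_finite_Union)
      (use assms PiM_pmf_pair(1)[OF assms(1)] in \<open>auto simp: disjoint_family_on_def prod_eq_iff\<close>)
  then show ?prob
    unfolding eq by (simp add: PiM_pmf_pair(2)[OF assms(1)] case_prod_unfold)
qed

text \<open>A union bound. The event \<open>B\<close> says that some off-diagonal entry of the
  \<open>N\<close> by \<open>N\<close> block comes from a pair of samples outside \<open>A\<close>.
  Off \<open>B\<close> the block agrees with that of \<open>c\<close>, so the error is at most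
  \<open>e\<close>; on \<open>B\<close> it is at most \<open>K\<close>.\<close>

lemma sampling_measure_integral_approx:
  fixes b :: real and d :: "'v \<Rightarrow> 'v \<Rightarrow> real" and p :: "'v pmf"
    and f :: "(nat \<Rightarrow> nat \<Rightarrow> real) \<Rightarrow> real"
  defines "h \<equiv> (\<lambda>\<xi> (i::nat) (j::nat). if i = j then 0 else d (\<xi> i) (\<xi> j))"
    and "c \<equiv> (\<lambda>i j. if i = j then 0 else b)"
  assumes d: "(\<lambda>(x, y). d x y) \<in> borel_measurable (measure_pmf p \<Otimes>\<^sub>M measure_pmf p)"
    and f: "f \<in> borel_measurable borel"
    and K: "\<And>a. \<bar>f a - f c\<bar> \<le> K"
    and e: "e \<ge> 0" "\<And>a. (\<And>i j. i < N \<Longrightarrow> j < N \<Longrightarrow> a i j = c i j) \<Longrightarrow> \<bar>f a - f c\<bar> \<le> e"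
    and A: "finite A" "\<And>u v. (u, v) \<in> A \<Longrightarrow> d u v = b"
  shows "\<bar>(\<integral>x. f x \<partial>sampling_measure d (measure_pmf p)) - f c\<bar>
    \<le> e + K * ((real N)\<^sup>2 * (1 - (\<Sum>(u, v)\<in>A. pmf p u * pmf p v)))"
proof -
  let ?P = "\<Pi>\<^sub>M _\<in>(UNIV::nat set). measure_pmf p"
  let ?q = "\<Sum>(u, v)\<in>A. pmf p u * pmf p v"
  \<comment> \<open>The diagonal can be left out because both matrices vanish there; for
    \<open>i = j\<close> the two samples would not be independent.\<close>
  define I where "I = {(i, j). i < N \<and> j < N \<and> i \<noteq> j}"
  define B where "B = (\<Union>(i, j)\<in>I. {\<xi> :: nat \<Rightarrow> 'v. (\<xi> i, \<xi> j) \<notin> A})"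
  interpret product_prob_space "\<lambda>_::nat. measure_pmf p" UNIV by (rule product_prob_space_pmf)
  have h [measurable]: "h \<in> borel_measurable ?P"
    unfolding h_def by (rule measurable_sampling[OF d])
  have sp: "space ?P = UNIV" by (simp add: space_PiM)
  have I_sub: "I \<subseteq> {..<N} \<times> {..<N}" by (auto simp: I_def)
  then have fin: "finite I" by (rule finite_subset) auto
  have card_I: "card I \<le> N\<^sup>2"
    using card_mono[OF _ I_sub] by (simp add: power2_eq_square)
  have compl: "{\<xi> :: nat \<Rightarrow> 'v. (\<xi> i, \<xi> j) \<notin> A} = space ?P - {\<xi>. (\<xi> i, \<xi> j) \<in> A}" for i j
    unfolding sp by auto
  have ev: "{\<xi> :: nat \<Rightarrow> 'v. (\<xi> i, \<xi> j) \<notin> A} \<in> sets ?P"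
    and pr: "measure ?P {\<xi> :: nat \<Rightarrow> 'v. (\<xi> i, \<xi> j) \<notin> A} = 1 - ?q" if "i \<noteq> j" for i j
    unfolding compl using PiM_pmf_pair_in[OF that A(1), of p]
    by (auto simp: P.prob_compl)
  have B: "B \<in> sets ?P"
    unfolding B_def using fin ev by (intro sets.finite_UN) (auto simp: I_def)
  \<comment> \<open>Any two distinct coordinates show that \<open>?q\<close> is a probability. The
    resulting sign of \<open>1 - ?q\<close> allows \<open>card I\<close> to be replaced by its upper
    bound.\<close>
  have "?q = measure ?P {\<xi>. (\<xi> 0, \<xi> 1) \<in> A}" by (subst PiM_pmf_pair_in(2)[OF _ A(1)]) auto
  then have q: "1 - ?q \<ge> 0" using P.prob_le_1 by simp
  have "measure ?P B \<le> (\<Sum>x\<in>I. measure ?P (case x of (i, j) \<Rightarrow> {\<xi>. (\<xi> i, \<xi> j) \<notin> A}))"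
    unfolding B_def using fin ev
    by (intro P.finite_measure_subadditive_finite) (auto simp: I_def)
  also have "\<dots> = real (card I) * (1 - ?q)"
    by (subst sum.cong[OF refl, of I _ "\<lambda>_. 1 - ?q"]) (auto simp: I_def pr)
  also have "\<dots> \<le> (real N)\<^sup>2 * (1 - ?q)"
    using card_I q by (intro mult_right_mono) (simp_all flip: of_nat_power)
  finally have B_le: "measure ?P B \<le> (real N)\<^sup>2 * (1 - ?q)" .
  have "K \<ge> 0" using K[of c] by simp
  have "(\<integral>x. f x \<partial>sampling_measure d (measure_pmf p)) = (\<integral>\<xi>. f (h \<xi>) \<partial>?P)"
    unfolding sampling_measure_def h_def[symmetric] using h f by (rule integral_distr)
  also have "\<bar>\<dots> - f c\<bar> \<le> e + K * measure ?P B"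
  proof (rule P.abs_expectation_diff_le[OF _ B K e(1)])
    show "(\<lambda>\<xi>. f (h \<xi>)) \<in> borel_measurable ?P" using h f by simp
    fix \<xi> assume "\<xi> \<in> space ?P - B"
    then show "\<bar>f (h \<xi>) - f c\<bar> \<le> e"
      by (intro e(2)) (auto simp: B_def I_def h_def c_def intro!: A(2))
  qed
  also have "\<dots> \<le> e + K * ((real N)\<^sup>2 * (1 - ?q))"
    using B_le \<open>K \<ge> 0\<close> by (intro add_left_mono mult_left_mono)
  finally show ?thesis .
qed

section \<open>Trees with a vertex of large outdegree\<close>

text \<open>The path through the parent has length 2. A shorter one is impossible: the siblings
  differ, and their addresses have equal length while those of adjacent vertices differ in length by
  one.\<close>

lemma graph_dist_siblings:
  assumes "v \<in> vertices T" "v @ [i] \<in> vertices T" "v @ [j] \<in> vertices T" "i \<noteq> j"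
  shows "graph_dist T (v @ [i]) (v @ [j]) = 2"
  unfolding graph_dist_def
proof (rule Least_equality)
  have "(v @ [i], v) \<in> adjacent T" "(v, v @ [j]) \<in> adjacent T"
    using assms by (auto simp: adjacent_def)
  then show "(v @ [i], v @ [j]) \<in> adjacent T ^^ 2" by (auto simp: numeral_2_eq_2)
next
  fix k assume k: "(v @ [i], v @ [j]) \<in> adjacent T ^^ k"
  have "k \<noteq> 0" using k assms(4) by (intro notI) simp
  moreover have "(v @ [i], v @ [j]) \<notin> adjacent T" by (auto simp: adjacent_def)
  then have "k \<noteq> 1" using k by auto
  ultimately show "2 \<le> k" by simp
qed

text \<open>\<open>C\<close> is the set of children of a vertex attaining the maximum, which exists
  because a tree has finitely many vertices and at least one.\<close>

lemma max_outdegree_siblings: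
  obtains C where "C \<subseteq> vertices T" "card C = max_outdegree T"
    "\<And>x y. x \<in> C \<Longrightarrow> y \<in> C \<Longrightarrow> x \<noteq> y \<Longrightarrow> graph_dist T x y = 2"
proof -
  have "max_outdegree T \<in> outdegree T ` vertices T"
    unfolding max_outdegree_def by (rule Max_in) auto
  then obtain v where v: "v \<in> vertices T" "max_outdegree T = outdegree T v" by auto
  let ?C = "(\<lambda>i. v @ [i]) ` {i. v @ [i] \<in> vertices T}"
  have "card ?C = max_outdegree T"
    unfolding v(2) outdegree_def by (intro card_image inj_onI) simp
  then show thesis
    by (intro that[of ?C]) (auto intro!: graph_dist_siblings v(1))
qed

lemma max_outdegree_le_tree_size: "max_outdegree T \<le> tree_size T"
  unfolding tree_size_def by (metis max_outdegree_siblings card_mono finite_vertices)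

lemma card_Times_minus_Id:
  assumes "finite C"
  shows "card (C \<times> C - Id) = card C * card C - card C"
proof -
  have "C \<times> C - Id = C \<times> C - (\<lambda>x. (x, x)) ` C" by auto
  moreover have "card ((\<lambda>x. (x, x)) ` C) = card C" by (intro card_image inj_onI) simp
  ultimately show ?thesis
    using assms by (simp add: card_Diff_subset image_subset_iff card_cartesian_product)
qed

text \<open>The threshold \<delta> depends on \<open>f\<close> and \<open>e\<close> but not on the
  tree. The lower bound on the outdegree ratio makes samples likely to be children of one vertex;
  the lower bound on the size makes coinciding samples unlikely.\<close>

lemma tree_sampling_integral_tendsto:
  fixes f :: "(nat \<Rightarrow> nat \<Rightarrow> real) \<Rightarrow> real"
  defines "c \<equiv> (\<lambda>i j. if i = j then 0 else 2)"
  assumes f: "continuous_on UNIV f" "bounded (range f)" and "e > 0"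
  obtains \<delta> where "\<delta> > 0" "\<And>T. real (max_outdegree T) / real (tree_size T) > 1 - \<delta> \<Longrightarrow>
    real (tree_size T) > 1 / \<delta> \<Longrightarrow> \<bar>(\<integral>x. f x \<partial>tree_sampling T) - f c\<bar> < e"
proof -
  obtain L where L: "\<And>a. \<bar>f a\<bar> \<le> L" using f(2) by (auto simp: bounded_iff)
  \<comment> \<open>\<open>2 * L\<close> already bounds the oscillation of \<open>f\<close>; the
    extra 1 makes \<open>K\<close> positive, as the quotient defining \<delta> requires.
    \<open>Suc\<close> below does the same for \<open>N\<close>.\<close>
  define K where "K = 2 * L + 1"
  have K: "\<bar>f a - f c\<bar> \<le> K" for a using L[of a] L[of c] by (simp add: K_def)
  have "K > 0" using L[of c] by (simp add: K_def)
  obtain N' where N': "\<And>a. (\<And>i j. i < N' \<Longrightarrow> j < N' \<Longrightarrow> a i j = c i j) \<Longrightarrow> \<bar>f a - f c\<bar> < e / 2"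
    using continuous_infinite_matrix_finite_dependence[OF f(1), of "e / 2" c] \<open>e > 0\<close> by auto
  define N where "N = Suc N'"
  have N: "\<bar>f a - f c\<bar> \<le> e / 2" if "\<And>i j. i < N \<Longrightarrow> j < N \<Longrightarrow> a i j = c i j" for a
    by (rule less_imp_le, rule N') (use that in \<open>auto simp: N_def\<close>)
  \<comment> \<open>A pair of samples will be shown to miss \<open>C \<times> C - Id\<close> with
    probability below \<open>3 * \<delta>\<close>; the factor 6 turns the resulting error
    \<open>K * N^2 * 3 * \<delta>\<close> into \<open>e / 2\<close>.\<close>
  define \<delta> where "\<delta> = e / (6 * K * (real N)\<^sup>2)"
  have "N > 0" by (simp add: N_def)
  then have KN: "K * (real N)\<^sup>2 > 0" using \<open>K > 0\<close> by simp
  then have "\<delta> > 0" using \<open>e > 0\<close> by (simp add: \<delta>_def mult.assoc)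
  show thesis
  proof (rule that[OF \<open>\<delta> > 0\<close>])
    fix T
    let ?n = "real (tree_size T)"
    define D where "D = max_outdegree T"
    define p where "p = pmf_of_set (vertices T)"
    assume D1: "real (max_outdegree T) / ?n > 1 - \<delta>" and n: "?n > 1 / \<delta>"
    obtain C where C: "C \<subseteq> vertices T" "card C = D"
        "\<And>x y. x \<in> C \<Longrightarrow> y \<in> C \<Longrightarrow> x \<noteq> y \<Longrightarrow> graph_dist T x y = 2"
      unfolding D_def using max_outdegree_siblings by blast
    have fin: "finite C" using C(1) by (rule finite_subset) simp
    have n0: "?n > 0" using tree_size_pos by simp
    have "pmf p u * pmf p v = 1 / ?n\<^sup>2" if "u \<in> C" "v \<in> C" for u v
      using that C(1) by (auto simp: p_def pmf_of_set tree_size_def indicator_def power2_eq_square)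
    then have "(\<Sum>(u, v)\<in>C \<times> C - Id. pmf p u * pmf p v) = (\<Sum>x\<in>C \<times> C - Id. 1 / ?n\<^sup>2)"
      by (intro sum.cong) auto
    also have "\<dots> = real (D * D - D) / ?n\<^sup>2"
      using fin by (simp add: card_Times_minus_Id C(2))
    finally have q: "(\<Sum>(u, v)\<in>C \<times> C - Id. pmf p u * pmf p v) = real (D * D - D) / ?n\<^sup>2" .
    define x where "x = real D / ?n"
    have x: "x > 1 - \<delta>" "x \<le> 1"
      using D1 max_outdegree_le_tree_size[of T] n0 by (auto simp: x_def D_def)
    \<comment> \<open>Ensures that the subtraction of natural numbers does not truncate.\<close>
    have "D \<le> D * D" by (cases D) auto
    then have eq: "real (D * D - D) / ?n\<^sup>2 = x\<^sup>2 - x / ?n"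
      by (simp add: x_def of_nat_diff diff_divide_distrib power2_eq_square)
    \<comment> \<open>The tangent line at 1 yields \<open>1 - x^2 < 2 * \<delta>\<close>; the third
      \<delta> pays for the diagonal term \<open>x / ?n\<close>.\<close>
    have "x\<^sup>2 \<ge> 2 * x - 1" using zero_le_power2[of "x - 1"] by (simp add: power2_eq_square algebra_simps)
    moreover have "x / ?n \<le> 1 / ?n" using x n0 by (intro divide_right_mono) auto
    moreover have "1 / ?n < \<delta>" using n n0 \<open>\<delta> > 0\<close> by (simp add: field_simps)
    ultimately have bd: "1 - real (D * D - D) / ?n\<^sup>2 < 3 * \<delta>"
      using x unfolding eq by linarith
    have "\<bar>(\<integral>x. f x \<partial>tree_sampling T) - f c\<bar> \<le> e / 2 + K * ((real N)\<^sup>2 *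
        (1 - (\<Sum>(u, v)\<in>C \<times> C - Id. pmf p u * pmf p v)))"
      unfolding tree_sampling_def p_def[symmetric] c_def
    proof (rule sampling_measure_integral_approx)
      show "(\<lambda>(u, v). real (graph_dist T u v)) \<in> borel_measurable (measure_pmf p \<Otimes>\<^sub>M measure_pmf p)"
        by (subst measurable_cong_sets[OF sets_pair_measure_cong[OF sets_measure_pmf_count_space
              sets_measure_pmf_count_space] refl])
          (simp add: pair_measure_countable)
      show "f \<in> borel_measurable borel" using f(1) by (rule borel_measurable_continuous_onI)
    qed (use K N C(3) fin \<open>e > 0\<close> in \<open>auto simp: c_def\<close>)
    also have "\<dots> = e / 2 + (K * (real N)\<^sup>2) * (1 - real (D * D - D) / ?n\<^sup>2)"
      by (simp add: q mult.assoc)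
    also have "\<dots> < e / 2 + (K * (real N)\<^sup>2) * (3 * \<delta>)"
      using bd KN by (intro add_strict_left_mono mult_strict_left_mono)
    also have "\<dots> = e" using \<open>K > 0\<close> \<open>N > 0\<close> by (simp add: \<delta>_def field_simps)
    finally show "\<bar>(\<integral>x. f x \<partial>tree_sampling T) - f c\<bar> < e" .
  qed
qed

text \<open>The hypothesis of the theorem divides the outdegree by \<open>n\<close>, the
  deterministic estimate by \<open>tree_size T\<close>; on the support the two agree.\<close>

lemma tree_size_simply_generated_tree:
  assumes "\<And>k. 0 \<le> w k" and "admissible w n" and "T \<in> set_pmf (simply_generated_tree w n)"
  shows "tree_size T = n"
  using assms(3) pmf_simply_generated_tree[OF assms(1,2), of T]
  by (auto simp: set_pmf_iff split: if_splits)

theorem theorem11p1: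
  fixes w :: "nat \<Rightarrow> real"
  assumes "\<And>k. 0 \<le> w k"
    and "\<And>z::real. z > 0 \<Longrightarrow> (\<Sum>k. ennreal (w k * z ^ k)) = \<infinity>"
    and "tendsto_in_prob euclideanreal (simply_generated_tree w)
           (\<lambda>n T. real (max_outdegree T) / real n) 1 (admissible_at_top w)"
  shows "tendsto_in_prob weak_topology (simply_generated_tree w)
           (\<lambda>n T. tree_sampling T) (Upsilon_sampling 1) (admissible_at_top w)"
  unfolding weak_topology_def
proof (rule tendsto_in_prob_topology_generated_by)
  fix S :: "(nat \<Rightarrow> nat \<Rightarrow> real) measure set"
  define c :: "nat \<Rightarrow> nat \<Rightarrow> real" where "c = (\<lambda>i j. if i = j then 0 else 2)"
  assume "S \<in> {{\<mu> \<in> borel_prob_measures. (\<integral>x. f x \<partial>\<mu>) \<in> V} |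
        (f :: (nat \<Rightarrow> nat \<Rightarrow> real) \<Rightarrow> real) V.
        continuous_on UNIV f \<and> bounded (range f) \<and> open V}"
    and mem: "Upsilon_sampling 1 \<in> S"
  then obtain f :: "(nat \<Rightarrow> nat \<Rightarrow> real) \<Rightarrow> real" and V
    where S: "S = {\<mu> \<in> borel_prob_measures. (\<integral>x. f x \<partial>\<mu>) \<in> V}"
      and f: "continuous_on UNIV f" "bounded (range f)" and "open V"
    by blast
  \<comment> \<open>The limit is the Dirac measure at \<open>c\<close>, so membership in
    \<open>S\<close> becomes a condition on the single value \<open>f c\<close>.\<close>
  have "(\<integral>x. f x \<partial>Upsilon_sampling 1) = f c"
    unfolding Upsilon_sampling_eq c_def mult_1_right using borel_measurable_continuous_onI[OF f(1)]
    by (subst integral_return) auto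
  then have "f c \<in> V" using mem by (simp add: S)
  then obtain e where e: "e > 0" "ball (f c) e \<subseteq> V" using \<open>open V\<close> openE by blast
  obtain \<delta> where \<delta>: "\<delta> > 0" "\<And>T. real (max_outdegree T) / real (tree_size T) > 1 - \<delta> \<Longrightarrow>
      real (tree_size T) > 1 / \<delta> \<Longrightarrow> \<bar>(\<integral>x. f x \<partial>tree_sampling T) - f c\<bar> < e"
    using tree_sampling_integral_tendsto[OF f e(1)] unfolding c_def by blast
  \<comment> \<open>The ray is a neighbourhood of 1, to which the assumed convergence of the
    outdegree ratio applies.\<close>
  have "openin euclideanreal {1 - \<delta><..} \<and> 1 \<in> {1 - \<delta><..}" using \<open>\<delta> > 0\<close> by simp
  then have lim: "((\<lambda>n. measure_pmf.prob (simply_generated_tree w n)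
      {T. real (max_outdegree T) / real n \<in> {1 - \<delta><..}}) \<longlongrightarrow> 1) (admissible_at_top w)"
    using assms(3) unfolding tendsto_in_prob_def by blast
  have "eventually (\<lambda>n. admissible w n \<and> real n > 1 / \<delta>) (admissible_at_top w)"
    unfolding admissible_at_top_def eventually_inf_principal
    using filterlim_real_sequentially[unfolded filterlim_at_top_dense, rule_format, of "1 / \<delta>"]
    by eventually_elim simp
  then have "eventually (\<lambda>n. measure_pmf.prob (simply_generated_tree w n)
        {T. real (max_outdegree T) / real n \<in> {1 - \<delta><..}}
      \<le> measure_pmf.prob (simply_generated_tree w n) {T. tree_sampling T \<in> S}) (admissible_at_top w)"
  proof eventually_elim
    case (elim n)
    have "tree_sampling T \<in> S"
      if "T \<in> set_pmf (simply_generated_tree w n)" "real (max_outdegree T) / real n > 1 - \<delta>" for T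
    proof -
      have "tree_size T = n" using tree_size_simply_generated_tree assms(1) elim that(1) by blast
      then have "\<bar>(\<integral>x. f x \<partial>tree_sampling T) - f c\<bar> < e" using \<delta>(2)[of T] that(2) elim by simp
      then have "(\<integral>x. f x \<partial>tree_sampling T) \<in> V"
        using e(2) by (auto simp: dist_real_def abs_minus_commute subset_iff)
      then show ?thesis by (simp add: S tree_sampling_in_borel_prob_measures)
    qed
    \<comment> \<open>The inclusion of events holds only on the support, where trees have size
      \<open>n\<close>, hence the almost-everywhere form of monotonicity.\<close>
    then show ?case
      by (intro measure_pmf.finite_measure_mono_AE) (auto simp: AE_measure_pmf_iff)
  qed
  then show "((\<lambda>n. measure_pmf.prob (simply_generated_tree w n) {T. tree_sampling T \<in> S})
      \<longlongrightarrow> 1) (admissible_at_top w)"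
    by (intro tendsto_sandwich[OF _ _ lim tendsto_const]) auto
qed

end
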